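(* Every randomized online algorithm for problem SP has expected competitive ratio at least $2$.
   Context: Fix a horizon $T\in\mathbb{N}$, a constant cancellation fee $\beta>0$ and a constant $H$. At each time $t\in\{1,\dots,T\}$ an input $\sigma_t=(e_t,p^0_t,p^1_t,B_t)$ determines a cost function $g_t:\{0,1\}\to\mathbb{R}$ by $g_t(1)=e_t p^1_t$ and $g_t(0)=e_t p^0_t+(p^1_t-p^0_t)(e_t-1.1B_t)^+-H(0.9B_t-e_t)^+$, where $(x)^+=\max\{x,0\}$; these cost functions are taken to be nonnegative. Problem SP: given $\boldsymbol{\sigma}=(\sigma_1,\dots,\sigma_T)$, minimize $\mathrm{Cost}(\boldsymbol{s})=\sum_{t=1}^T\big(g_t(s_t)+\beta(s_t-s_{t-1})^+\big)$ over $(s_1,\dots,s_T)\in\{0,1\}^T$, with initial state $s_0=0$; $\mathrm{Opt}(s_0,\boldsymbol{\sigma})$ is the optimal value. A randomized online algorithm $\mathcal{A}$ chooses each $s_t$ (possibly at random) based only on $\sigma_1,\dots,\sigma_t$ and its past random choices; its expected competitive ratio is the smallest $c$ such that there is a constant $\gamma(s_0)$ depending only on $s_0$ with $\mathbb{E}[\mathrm{Cost}_{\mathcal{A}}(s_0,\boldsymbol{\sigma})]\le c\cdot\mathrm{Opt}(s_0,\boldsymbol{\sigma})+\gamma(s_0)$ for all input sequences $\boldsymbol{\sigma}$. *)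

theory Defs
  imports "HOL-Probability.Probability"
begin

text \<open>An input is a quadruple (e, p0, p1, B).\<close>

type_synonym input = "real \<times> real \<times> real \<times> real"

text \<open>States are the numbers 0 and 1; the value at any other number is irrelevant.\<close>

fun op_cost :: "real \<Rightarrow> input \<Rightarrow> nat \<Rightarrow> real" where
  "op_cost H (e, p0, p1, B) s =
     (if s = 1 then e * p1
      else e * p0 + (p1 - p0) * max (e - 1.1 * B) 0 - H * max (0.9 * B - e) 0)"

definition admissible :: "real \<Rightarrow> input \<Rightarrow> bool" where
  "admissible H x \<longleftrightarrow> (\<forall>s\<in>{0, 1}. 0 \<le> op_cost H x s)"

text \<open>Lists are indexed from 0, so \<open>\<sigma> ! t\<close> and \<open>s ! t\<close> belong to time \<open>t + 1\<close>,
  and \<open>(s0 # s) ! t\<close> is the state preceding \<open>s ! t\<close>.\<close>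

definition cost :: "real \<Rightarrow> real \<Rightarrow> nat \<Rightarrow> input list \<Rightarrow> nat list \<Rightarrow> real" where
  "cost \<beta> H s0 \<sigma> s =
     (\<Sum>t<length \<sigma>. op_cost H (\<sigma> ! t) (s ! t)
        + \<beta> * max (real (s ! t) - real ((s0 # s) ! t)) 0)"

definition opt :: "real \<Rightarrow> real \<Rightarrow> nat \<Rightarrow> input list \<Rightarrow> real" where
  "opt \<beta> H s0 \<sigma> = Min (cost \<beta> H s0 \<sigma> ` {s. length s = length \<sigma> \<and> set s \<subseteq> {0, 1}})"

text \<open>A randomized online algorithm makes a random choice \<open>R t\<close> at each time, all on one
  probability space \<open>M\<close>, and picks its state by a rule \<open>D\<close> from the horizon, the inputs seen
  so far and the random choices made so far. The \<open>R t\<close> may have any type and any joint law.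
  Choosing the next state with a probability that depends on the inputs so far and on the
  earlier choices is the case where the \<open>R t\<close> are independent and uniform on \<open>[0, 1]\<close>:
  \<open>D\<close> recomputes the earlier choices and compares the latest \<open>R t\<close> with the resulting probability.\<close>

definition choices :: "(nat \<Rightarrow> 'w \<Rightarrow> 'r) \<Rightarrow> nat \<Rightarrow> 'w \<Rightarrow> 'r list" where
  "choices R t \<omega> = map (\<lambda>i. R i \<omega>) [0..<t]"

definition randomized_online_algorithm ::
  "'w measure \<Rightarrow> (nat \<Rightarrow> 'w \<Rightarrow> 'r) \<Rightarrow> (nat \<Rightarrow> input list \<Rightarrow> 'r list \<Rightarrow> nat) \<Rightarrow> bool" where
  "randomized_online_algorithm M R D \<longleftrightarrow>
     prob_space M \<and>
     (\<forall>T h. (\<lambda>\<omega>. D T h (choices R (length h) \<omega>)) \<in> measurable M (count_space {0, 1}))"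

definition schedule ::
  "(nat \<Rightarrow> 'w \<Rightarrow> 'r) \<Rightarrow> (nat \<Rightarrow> input list \<Rightarrow> 'r list \<Rightarrow> nat) \<Rightarrow> input list \<Rightarrow> 'w \<Rightarrow> nat list" where
  "schedule R D \<sigma> \<omega> =
     map (\<lambda>t. D (length \<sigma>) (take t \<sigma>) (choices R t \<omega>)) [1..<Suc (length \<sigma>)]"

definition expected_cost ::
  "real \<Rightarrow> real \<Rightarrow> nat \<Rightarrow> 'w measure \<Rightarrow> (nat \<Rightarrow> 'w \<Rightarrow> 'r) \<Rightarrow>
   (nat \<Rightarrow> input list \<Rightarrow> 'r list \<Rightarrow> nat) \<Rightarrow> input list \<Rightarrow> real" where
  "expected_cost \<beta> H s0 M R D \<sigma> = (\<integral>\<omega>. cost \<beta> H s0 \<sigma> (schedule R D \<sigma> \<omega>) \<partial>M)"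

text \<open>The additive constant is uniform in the horizon \<open>T = length \<sigma>\<close>. If it could depend on
  \<open>T\<close>, minimizing each cost function separately would be 1-competitive, with constant
  \<open>T * \<beta>\<close>.\<close>

definition competitive ::
  "real \<Rightarrow> real \<Rightarrow> nat \<Rightarrow> 'w measure \<Rightarrow> (nat \<Rightarrow> 'w \<Rightarrow> 'r) \<Rightarrow>
   (nat \<Rightarrow> input list \<Rightarrow> 'r list \<Rightarrow> nat) \<Rightarrow> real \<Rightarrow> bool" where
  "competitive \<beta> H s0 M R D c \<longleftrightarrow>
     (\<exists>\<gamma>::real. \<forall>\<sigma>. \<sigma> \<noteq> [] \<and> (\<forall>x\<in>set \<sigma>. admissible H x) \<longrightarrow>
        expected_cost \<beta> H s0 M R D \<sigma> \<le> c * opt \<beta> H s0 \<sigma> + \<gamma>)"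

text \<open>The infimum is taken in the extended reals, so the ratio is \<open>\<infinity>\<close> if no \<open>c\<close> works.\<close>

definition expected_competitive_ratio ::
  "real \<Rightarrow> real \<Rightarrow> nat \<Rightarrow> 'w measure \<Rightarrow> (nat \<Rightarrow> 'w \<Rightarrow> 'r) \<Rightarrow>
   (nat \<Rightarrow> input list \<Rightarrow> 'r list \<Rightarrow> nat) \<Rightarrow> ereal" where
  "expected_competitive_ratio \<beta> H s0 M R D = Inf (ereal ` {c. competitive \<beta> H s0 M R D c})"

end

theory Submission imports Defs begin

text \<open>
  Write \<open>y\<close> for the probability that the algorithm is in state 1; its expected cost is at least
  the cost of the fractional trajectory \<open>y\<close>. The adversary only uses the inputs \<open>(1, \<epsilon>, 0, 1)\<close> and
  \<open>(1, 0, \<epsilon>, 1)\<close> with \<open>\<epsilon> = \<beta> / n\<close>, which charge \<open>\<epsilon>\<close> to state 0 and to state 1, respectively. It keeps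
  a reference point \<open>x = k / n\<close>, which encodes the difference of the work functions of the two states.
  While \<open>y\<close> is below \<open>x\<close> it charges state 0 and \<open>x\<close> moves up by \<open>1 / n\<close>, while \<open>y\<close> is above \<open>x\<close> it
  charges state 1 and \<open>x\<close> moves down, so that \<open>x\<close> always runs away from \<open>y\<close>. The optimum grows only
  in the up steps, by \<open>\<epsilon>\<close>. With the potential \<open>\<beta> (x - y)\<^sup>+ + \<beta> x\<^sup>2 / 2\<close> the algorithm
  pays amortized \<open>2 \<epsilon>\<close> in every up step and \<open>0\<close> in every down step, up to \<open>O(\<epsilon> / n)\<close>. If \<open>x\<close> is at
  the end of \<open>[0, 1]\<close> that is away from \<open>y\<close>, repeating the charge costs the optimum nothing, while
  the cost of the algorithm grows without bound if this happens too often.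
\<close>

section \<open>Costs of fractional and integral trajectories\<close>

text \<open>\<open>Y\<close> maps an input history to the probability of state 1, so it can be
  probed while the sequence is being built. \<open>Y []\<close> is the initial state.\<close>

definition frac_cost :: "real \<Rightarrow> real \<Rightarrow> (input list \<Rightarrow> real) \<Rightarrow> input list \<Rightarrow> real" where
  "frac_cost \<beta> H Y \<sigma> =
     (\<Sum>t<length \<sigma>. op_cost H (\<sigma> ! t) 0 * (1 - Y (take (Suc t) \<sigma>))
        + op_cost H (\<sigma> ! t) 1 * Y (take (Suc t) \<sigma>)
        + \<beta> * max (Y (take (Suc t) \<sigma>) - Y (take t \<sigma>)) 0)"

lemma frac_cost_Nil [simp]: "frac_cost \<beta> H Y [] = 0"
  by (simp add: frac_cost_def)

lemma frac_cost_snoc: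
  "frac_cost \<beta> H Y (\<sigma> @ [x]) = frac_cost \<beta> H Y \<sigma>
     + op_cost H x 0 * (1 - Y (\<sigma> @ [x])) + op_cost H x 1 * Y (\<sigma> @ [x])
     + \<beta> * max (Y (\<sigma> @ [x]) - Y \<sigma>) 0"
  by (simp add: frac_cost_def nth_append)

lemma cost_snoc:
  assumes "length s = length \<sigma>"
  shows "cost \<beta> H s0 (\<sigma> @ [x]) (s @ [j]) = cost \<beta> H s0 \<sigma> s + op_cost H x j
           + \<beta> * max (real j - real (last (s0 # s))) 0"
proof -
  have "(s0 # s @ [j]) ! t = (s0 # s) ! t" if "t \<le> length \<sigma>" for t
    using that assms by (cases t) (auto simp: nth_append)
  moreover have "(s0 # s) ! length \<sigma> = last (s0 # s)"
    by (simp add: assms[symmetric] last_conv_nth)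
  ultimately show ?thesis
    using assms by (simp add: cost_def nth_append)
qed

section \<open>Bounds on the optimum\<close>

lemma finite_schedules: "finite {s :: nat list. length s = n \<and> set s \<subseteq> {0, 1}}"
  using finite_lists_length_eq[of "{0, 1 :: nat}" n] by (simp add: conj_commute)

lemma opt_le_cost:
  assumes "length s = length \<sigma>" "set s \<subseteq> {0, 1}"
  shows "opt \<beta> H s0 \<sigma> \<le> cost \<beta> H s0 \<sigma> s"
  unfolding opt_def using assms finite_schedules by (intro Min_le) auto

text \<open>The state \<open>j\<close> is the one moved to after the last input: counting this final move makes
  the bounds for the two states hold exactly also at the ends of the grid.\<close>

definition reachable_within ::
  "real \<Rightarrow> real \<Rightarrow> input list \<Rightarrow> nat \<Rightarrow> real \<Rightarrow> bool" where
  "reachable_within \<beta> H \<sigma> j b \<longleftrightarrow>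
     (\<exists>s. length s = length \<sigma> \<and> set s \<subseteq> {0, 1} \<and>
        cost \<beta> H 0 \<sigma> s + \<beta> * max (real j - real (last (0 # s))) 0 \<le> b)"

text \<open>One half of the work function recursion: serve \<open>x\<close> in the state
  \<open>i\<close> in which the old bound ends, then move to \<open>j\<close>.\<close>

lemma reachable_within_snoc:
  assumes "reachable_within \<beta> H \<sigma> i b" "i \<in> {0, 1}"
    and "b + op_cost H x i + \<beta> * max (real j - real i) 0 \<le> b'"
  shows "reachable_within \<beta> H (\<sigma> @ [x]) j b'"
proof -
  obtain s where s: "length s = length \<sigma>" "set s \<subseteq> {0, 1}"
    "cost \<beta> H 0 \<sigma> s + \<beta> * max (real i - real (last (0 # s))) 0 \<le> b"
    using assms(1) unfolding reachable_within_def by blast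
  show ?thesis
    unfolding reachable_within_def
    using s assms by (intro exI[of _ "s @ [i]"]) (auto simp: cost_snoc)
qed

lemma opt_le_if_reachable_within:
  assumes "reachable_within \<beta> H \<sigma> 0 b"
  shows "opt \<beta> H 0 \<sigma> \<le> b"
proof -
  obtain s where "length s = length \<sigma>" "set s \<subseteq> {0, 1}" "cost \<beta> H 0 \<sigma> s \<le> b"
    using assms unfolding reachable_within_def by auto
  then show ?thesis using opt_le_cost[of s \<sigma> \<beta> H 0] by linarith
qed

lemma opt_nonneg:
  assumes "\<beta> \<ge> 0" "\<forall>x\<in>set \<sigma>. admissible H x"
  shows "opt \<beta> H 0 \<sigma> \<ge> 0"
proof -
  have "cost \<beta> H 0 \<sigma> s \<ge> 0" if "length s = length \<sigma>" "set s \<subseteq> {0, 1}" for s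
    unfolding cost_def
  proof (intro sum_nonneg add_nonneg_nonneg)
    fix t assume t: "t \<in> {..<length \<sigma>}"
    then have "s ! t \<in> {0, 1}" "\<sigma> ! t \<in> set \<sigma>"
      using that nth_mem[of t s] by fastforce+
    then show "op_cost H (\<sigma> ! t) (s ! t) \<ge> 0"
      using assms(2) unfolding admissible_def by blast
  qed (use assms in auto)
  moreover have "{s :: nat list. length s = length \<sigma> \<and> set s \<subseteq> {0, 1}} \<noteq> {}"
    by (auto intro!: exI[of _ "replicate (length \<sigma>) 0"])
  ultimately show ?thesis
    unfolding opt_def using finite_schedules by (subst Min_ge_iff) auto
qed

section \<open>Amortized cost of a single step\<close>

text \<open>If \<open>y'\<close> overshoots \<open>x + \<eta>\<close>, the charge shrinks by
  \<open>\<eta>\<close> times the overshoot, but the movement pays for the overshoot in full. The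
  change of \<open>x^2 / 2\<close> cancels the remaining dependence on \<open>x\<close>.\<close>

lemma up_step_amortized:
  fixes \<beta> \<eta> \<theta> x y y' :: real
  assumes "\<beta> \<ge> 0" "0 \<le> \<eta>" "\<eta> \<le> 1" "\<theta> \<ge> 0" "y \<le> x + \<theta>"
  shows "\<beta> * \<eta> * (1 - y') + \<beta> * max (y' - y) 0
           + (\<beta> * max (x + \<eta> - y') 0 + \<beta> * (x + \<eta>)\<^sup>2 / 2) - (\<beta> * max (x - y) 0 + \<beta> * x\<^sup>2 / 2)
         \<ge> 2 * (\<beta> * \<eta>) - \<beta> * (\<eta>\<^sup>2 / 2 + \<theta>)"
proof -
  have *: "max (y' - y) 0 + max (x + \<eta> - y') 0 - max (x - y) 0 \<ge> \<eta> - \<theta> + max (y' - (x + \<eta>)) 0"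
    using assms by linarith
  have "\<eta> * (y' - (x + \<eta>)) \<le> max (y' - (x + \<eta>)) 0"
    using assms by (cases "y' \<le> x + \<eta>") (auto simp: max_def mult_nonneg_nonpos mult_left_le_one_le)
  with * have "\<eta> * (1 - y') + max (y' - y) 0 + max (x + \<eta> - y') 0 - max (x - y) 0
      \<ge> \<eta> * (1 - y') + \<eta> - \<theta> + \<eta> * (y' - (x + \<eta>))"
    by linarith
  then have "\<eta> * (1 - y') + max (y' - y) 0 + max (x + \<eta> - y') 0 - max (x - y) 0
      + (x + \<eta>)\<^sup>2 / 2 - x\<^sup>2 / 2 \<ge> 2 * \<eta> - (\<eta>\<^sup>2 / 2 + \<theta>)"
    by (simp add: power2_eq_square add_divide_distrib diff_divide_distrib algebra_simps)
  from mult_left_mono[OF this \<open>\<beta> \<ge> 0\<close>] show ?thesis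
    by (simp add: algebra_simps)
qed

text \<open>An undershoot of \<open>y'\<close> below \<open>x - \<eta>\<close> saves charge, and the
  potential term \<open>max (x - \<eta> - y') 0\<close> outweighs the saving.\<close>

lemma down_step_amortized:
  fixes \<beta> \<eta> \<theta> x y y' :: real
  assumes "\<beta> \<ge> 0" "0 \<le> \<eta>" "\<eta> \<le> 1" "\<theta> \<ge> 0" "y \<ge> x - \<theta>"
  shows "\<beta> * \<eta> * y' + \<beta> * max (y' - y) 0
           + (\<beta> * max (x - \<eta> - y') 0 + \<beta> * (x - \<eta>)\<^sup>2 / 2) - (\<beta> * max (x - y) 0 + \<beta> * x\<^sup>2 / 2)
         \<ge> - \<beta> * (\<eta>\<^sup>2 / 2 + \<theta>)"
proof -
  have "\<eta> * (x - \<eta> - y') \<le> max (x - \<eta> - y') 0"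
    using assms by (cases "x - \<eta> \<le> y'") (auto simp: max_def mult_nonneg_nonpos mult_left_le_one_le)
  moreover have "max (y' - y) 0 - max (x - y) 0 \<ge> - \<theta>"
    using assms by linarith
  ultimately have "\<eta> * y' + max (y' - y) 0 + max (x - \<eta> - y') 0 - max (x - y) 0
      \<ge> \<eta> * y' + \<eta> * (x - \<eta> - y') - \<theta>"
    by linarith
  then have "\<eta> * y' + max (y' - y) 0 + max (x - \<eta> - y') 0 - max (x - y) 0
      + (x - \<eta>)\<^sup>2 / 2 - x\<^sup>2 / 2 \<ge> - (\<eta>\<^sup>2 / 2 + \<theta>)"
    by (simp add: power2_eq_square add_divide_distrib diff_divide_distrib algebra_simps)
  from mult_left_mono[OF this \<open>\<beta> \<ge> 0\<close>] show ?thesis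
    by (simp add: algebra_simps)
qed

text \<open>\<open>u\<close> is a lower bound for the charged mass before the move,
  \<open>u'\<close> the mass after it and \<open>v\<close> the change of \<open>Y\<close>. As
  \<open>2 * max v 0 - v = |v|\<close> and \<epsilon> \<le> \<beta>, escaping a charge costs at
  least as much as bearing it.\<close>

lemma charge_and_move_ge:
  fixes \<epsilon> \<beta> u u' v :: real
  assumes "0 \<le> \<epsilon>" "\<epsilon> \<le> \<beta>" "0 \<le> u'" "\<bar>v\<bar> \<ge> u - u'"
  shows "2 * (\<epsilon> * u' + \<beta> * max v 0) - \<beta> * v \<ge> \<epsilon> * u"
proof -
  have "\<epsilon> * (u - u') \<le> \<epsilon> * \<bar>v\<bar>" using assms by (intro mult_left_mono) auto
  also have "\<dots> \<le> \<beta> * \<bar>v\<bar>" using assms by (intro mult_right_mono) auto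
  also have "\<dots> = 2 * (\<beta> * max v 0) - \<beta> * v" by (simp add: max_def)
  finally show ?thesis using mult_nonneg_nonneg[OF assms(1,3)] by (simp add: algebra_simps)
qed

section \<open>The adversarial input sequence\<close>

text \<open>\<open>U\<close> and \<open>S\<close> count the up steps and the steps in which the reference point is stuck at an
  end of the grid; the number of down steps is \<open>U - k\<close>. A stuck step may cost the algorithm nothing
  if it escapes to state 0 for free. Doubling the cost and subtracting \<open>\<beta> y\<close> makes moves
  in both directions cost \<open>\<beta>\<close>.\<close>

lemma adversary:
  fixes \<beta> H :: real and Y :: "input list \<Rightarrow> real" and n m :: nat
  assumes \<beta>: "\<beta> > 0" and n: "n > 0"
    and Y0: "Y [] = 0" and Y: "\<And>h. 0 \<le> Y h \<and> Y h \<le> 1"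
  defines "\<epsilon> \<equiv> \<beta> / n" and "\<theta> \<equiv> 1 / (2 * (real n)\<^sup>2)"
  shows "\<exists>\<sigma> k U S. length \<sigma> = m \<and> (\<forall>x\<in>set \<sigma>. admissible H x) \<and> k \<le> n \<and> m + k = 2 * U + S \<and>
    reachable_within \<beta> H \<sigma> 0 (\<epsilon> * U) \<and> reachable_within \<beta> H \<sigma> 1 (\<epsilon> * U + \<beta> - \<epsilon> * k) \<and>
    2 * frac_cost \<beta> H Y \<sigma> - \<beta> * Y \<sigma> \<ge> \<epsilon> * \<theta> * S \<and>
    frac_cost \<beta> H Y \<sigma> + (\<beta> * max (k / n - Y \<sigma>) 0 + \<beta> * (k / n)\<^sup>2 / 2)
      \<ge> 2 * \<epsilon> * U - \<epsilon> / n * (2 * real U - k)"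
proof (induction m)
  case 0
  have "reachable_within \<beta> H [] 0 0" "reachable_within \<beta> H [] 1 \<beta>"
    by (simp_all add: reachable_within_def cost_def)
  then show ?case
    by (intro exI[of _ "[]"] exI[of _ "0::nat"]) (simp add: Y0)
next
  case (Suc m)
  then obtain \<sigma> k U S where IH:
    "length \<sigma> = m" "\<forall>x\<in>set \<sigma>. admissible H x" "k \<le> n" "m + k = 2 * U + S"
    "reachable_within \<beta> H \<sigma> 0 (\<epsilon> * U)" "reachable_within \<beta> H \<sigma> 1 (\<epsilon> * U + \<beta> - \<epsilon> * k)"
    and F1: "2 * frac_cost \<beta> H Y \<sigma> - \<beta> * Y \<sigma> \<ge> \<epsilon> * \<theta> * S"
    and F2: "frac_cost \<beta> H Y \<sigma> + (\<beta> * max (k / n - Y \<sigma>) 0 + \<beta> * (k / n)\<^sup>2 / 2)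
      \<ge> 2 * \<epsilon> * U - \<epsilon> / n * (2 * real U - k)"
    by blast
  define \<eta> where "\<eta> = 1 / real n"
  have \<eta>: "0 \<le> \<eta>" "\<eta> \<le> 1" using n by (auto simp: \<eta>_def)
  have \<epsilon>: "0 < \<epsilon>" "\<epsilon> \<le> \<beta>" "\<epsilon> * n = \<beta>" "\<epsilon> = \<beta> * \<eta>"
    using \<beta> n by (auto simp: \<epsilon>_def \<eta>_def field_simps)
  have \<theta>: "\<theta> \<ge> 0" by (simp add: \<theta>_def)
  \<comment> \<open>This choice of \<open>\<theta>\<close> makes each of the
    \<open>U + (U - k)\<close> up and down steps lose at most \<open>\<epsilon> / n\<close>, whence
    the error term.\<close>
  have loss: "\<beta> * (\<eta>\<^sup>2 / 2 + \<theta>) = \<epsilon> / n"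
    using n by (simp add: \<epsilon>_def \<eta>_def \<theta>_def power2_eq_square field_simps)
  \<comment> \<open>As e = B = 1, both positive parts in \<open>op_cost\<close> vanish and the
    prices alone set the charge.\<close>
  define A B :: input where "A = (1, \<epsilon>, 0, 1)" and "B = (1, 0, \<epsilon>, 1)"
  have opA: "op_cost H A 0 = \<epsilon>" "op_cost H A (Suc 0) = 0" and opB: "op_cost H B 0 = 0" "op_cost H B (Suc 0) = \<epsilon>"
    by (auto simp: A_def B_def)
  have adm: "admissible H A" "admissible H B"
    using opA opB \<epsilon> by (auto simp: admissible_def)
  have FA: "frac_cost \<beta> H Y (\<sigma> @ [A]) = frac_cost \<beta> H Y \<sigma> + \<epsilon> * (1 - Y (\<sigma> @ [A]))
      + \<beta> * max (Y (\<sigma> @ [A]) - Y \<sigma>) 0"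
    and FB: "frac_cost \<beta> H Y (\<sigma> @ [B]) = frac_cost \<beta> H Y \<sigma> + \<epsilon> * Y (\<sigma> @ [B])
      + \<beta> * max (Y (\<sigma> @ [B]) - Y \<sigma>) 0"
    by (simp_all add: frac_cost_snoc opA opB)
  \<comment> \<open>\<open>u = 0\<close> will serve the up steps, where this quantity must not
    decrease, and \<open>u = \<theta>\<close> the stuck ones, where it must grow.\<close>
  have stepA: "2 * frac_cost \<beta> H Y (\<sigma> @ [A]) - \<beta> * Y (\<sigma> @ [A])
      \<ge> 2 * frac_cost \<beta> H Y \<sigma> - \<beta> * Y \<sigma> + \<epsilon> * u" if "u \<le> 1 - Y \<sigma>" for u
  proof -
    have "u - (1 - Y (\<sigma> @ [A])) \<le> \<bar>Y (\<sigma> @ [A]) - Y \<sigma>\<bar>"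
      using that by linarith
    from charge_and_move_ge[OF _ _ _ this, of \<epsilon> \<beta>] show ?thesis
      using \<epsilon>(1,2) Y[of "\<sigma> @ [A]"] unfolding FA by (simp add: right_diff_distrib distrib_left)
  qed
  have stepB: "2 * frac_cost \<beta> H Y (\<sigma> @ [B]) - \<beta> * Y (\<sigma> @ [B])
      \<ge> 2 * frac_cost \<beta> H Y \<sigma> - \<beta> * Y \<sigma> + \<epsilon> * u" if "u \<le> Y \<sigma>" for u
  proof -
    have "u - Y (\<sigma> @ [B]) \<le> \<bar>Y (\<sigma> @ [B]) - Y \<sigma>\<bar>"
      using that by linarith
    from charge_and_move_ge[OF _ _ _ this, of \<epsilon> \<beta>] show ?thesis
      using \<epsilon>(1,2) Y[of "\<sigma> @ [B]"] unfolding FB by (simp add: right_diff_distrib distrib_left)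
  qed
  note snoc = reachable_within_snoc[OF IH(5)] reachable_within_snoc[OF IH(6)]
  \<comment> \<open>The margin \<open>\<theta>\<close> leaves more than mass \<open>\<theta>\<close>
    in the charged state whenever the reference point is stuck.\<close>
  consider (up) "k < n" "Y \<sigma> \<le> k / n + \<theta>" | (down) "k > 0" "Y \<sigma> \<ge> k / n - \<theta>"
    | (bot) "k = 0" "Y \<sigma> > \<theta>" | (top) "k = n" "Y \<sigma> < 1 - \<theta>"
    using n \<theta> \<open>k \<le> n\<close> by (cases "k = 0"; cases "k = n"; fastforce)
  then show ?case
  proof cases
    case up
    have x': "real (Suc k) / n = k / n + \<eta>" by (simp add: \<eta>_def add_divide_distrib)
    \<comment> \<open>The bound for state 0 rises by \<open>\<epsilon>\<close> and that for state 1
      stays, since \<open>U\<close> and \<open>k\<close> grow together.\<close>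
    have "reachable_within \<beta> H (\<sigma> @ [A]) 0 (\<epsilon> * Suc U)"
      by (rule snoc(1)) (auto simp: opA algebra_simps)
    moreover have "reachable_within \<beta> H (\<sigma> @ [A]) 1 (\<epsilon> * Suc U + \<beta> - \<epsilon> * Suc k)"
      by (rule snoc(2)) (auto simp: opA algebra_simps)
    moreover have "frac_cost \<beta> H Y (\<sigma> @ [A]) + (\<beta> * max (real (Suc k) / n - Y (\<sigma> @ [A])) 0
        + \<beta> * (real (Suc k) / n)\<^sup>2 / 2) \<ge> 2 * \<epsilon> * Suc U - \<epsilon> / n * (2 * real (Suc U) - Suc k)"
      using up_step_amortized[of \<beta> \<eta> \<theta> "Y \<sigma>" "k / n" "Y (\<sigma> @ [A])"] up \<beta> \<eta> \<theta> F2
      unfolding loss FA x' \<epsilon>(4)[symmetric] by (simp add: algebra_simps)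
    ultimately show ?thesis
      using IH adm stepA[of 0] Y[of \<sigma>] F1 up
      by (intro exI[of _ "\<sigma> @ [A]"] exI[of _ "Suc k"] exI[of _ "Suc U"] exI[of _ S])
         (simp del: of_nat_Suc)
  next
    case down
    then obtain j where j: "k = Suc j" by (cases k) auto
    have x': "real j / n = k / n - \<eta>" by (simp add: j \<eta>_def add_divide_distrib)
    have kj: "real k = real j + 1" by (simp add: j)
    have "reachable_within \<beta> H (\<sigma> @ [B]) 0 (\<epsilon> * U)"
      by (rule snoc(1)) (auto simp: opB algebra_simps)
    moreover have "reachable_within \<beta> H (\<sigma> @ [B]) 1 (\<epsilon> * U + \<beta> - \<epsilon> * j)"
      by (rule snoc(2)) (auto simp: opB algebra_simps j)
    moreover have "frac_cost \<beta> H Y (\<sigma> @ [B]) + (\<beta> * max (real j / n - Y (\<sigma> @ [B])) 0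
        + \<beta> * (real j / n)\<^sup>2 / 2) \<ge> 2 * \<epsilon> * U - \<epsilon> / n * (2 * real U - j)"
    proof -
      have "\<epsilon> / n * (2 * real U - j) = \<epsilon> / n * (2 * real U - k) + \<epsilon> / n"
        by (simp add: kj add_divide_distrib algebra_simps)
      then show ?thesis
        using down_step_amortized[of \<beta> \<eta> \<theta> "k / n" "Y \<sigma>" "Y (\<sigma> @ [B])"] down \<beta> \<eta> \<theta> F2 loss
        unfolding FB x' \<epsilon>(4)[symmetric] by linarith
    qed
    ultimately show ?thesis
      using IH adm stepB[of 0] Y[of \<sigma>] F1 j
      by (intro exI[of _ "\<sigma> @ [B]"] exI[of _ j] exI[of _ U] exI[of _ S]) simp
  next
    case bot
    have "reachable_within \<beta> H (\<sigma> @ [B]) 0 (\<epsilon> * U)"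
      by (rule snoc(1)) (auto simp: opB)
    \<comment> \<open>Serving in state 0 is free and the final move costs \<beta>, so the bound for
      state 1 does not grow.\<close>
    moreover have "reachable_within \<beta> H (\<sigma> @ [B]) 1 (\<epsilon> * U + \<beta> - \<epsilon> * k)"
      by (rule snoc(1)) (auto simp: opB bot)
    moreover have "2 * frac_cost \<beta> H Y (\<sigma> @ [B]) - \<beta> * Y (\<sigma> @ [B]) \<ge> \<epsilon> * \<theta> * Suc S"
      using stepB[of \<theta>] bot F1 by (simp add: distrib_left)
    moreover have "frac_cost \<beta> H Y (\<sigma> @ [B]) + (\<beta> * max (k / n - Y (\<sigma> @ [B])) 0
        + \<beta> * (k / n)\<^sup>2 / 2) \<ge> 2 * \<epsilon> * U - \<epsilon> / n * (2 * real U - k)"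
      using F2 bot \<epsilon>(1) \<beta> Y[of \<sigma>] Y[of "\<sigma> @ [B]"] unfolding FB by (simp add: add_increasing2)
    ultimately show ?thesis
      using IH adm
      by (intro exI[of _ "\<sigma> @ [B]"] exI[of _ k] exI[of _ U] exI[of _ "Suc S"])
         (simp del: of_nat_Suc)
  next
    case top
    \<comment> \<open>At \<open>k = n\<close> the bounds for both states agree, so serving in state
      1 for free also covers ending in state 0.\<close>
    have "reachable_within \<beta> H (\<sigma> @ [A]) 0 (\<epsilon> * U)"
      by (rule snoc(2)) (auto simp: opA top \<epsilon>(3))
    moreover have "reachable_within \<beta> H (\<sigma> @ [A]) 1 (\<epsilon> * U + \<beta> - \<epsilon> * k)"
      by (rule snoc(2)) (auto simp: opA)
    moreover have "2 * frac_cost \<beta> H Y (\<sigma> @ [A]) - \<beta> * Y (\<sigma> @ [A]) \<ge> \<epsilon> * \<theta> * Suc S"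
      using stepA[of \<theta>] top F1 by (simp add: distrib_left)
    moreover have "frac_cost \<beta> H Y (\<sigma> @ [A]) + (\<beta> * max (k / n - Y (\<sigma> @ [A])) 0
        + \<beta> * (k / n)\<^sup>2 / 2) \<ge> 2 * \<epsilon> * U - \<epsilon> / n * (2 * real U - k)"
    proof -
      \<comment> \<open>At reference point 1 the potential is \<beta> (1 - Y) plus a constant:
        raising Y lowers it by what the movement costs.\<close>
      have "\<beta> * max (Y (\<sigma> @ [A]) - Y \<sigma>) 0 \<ge> \<beta> * (Y (\<sigma> @ [A]) - Y \<sigma>)"
        using \<beta> by (intro mult_left_mono) auto
      moreover have "\<beta> * max (k / n - Y h) 0 = \<beta> - \<beta> * Y h" for h
        using top n Y[of h] by (simp add: right_diff_distrib)
      moreover have "\<epsilon> * (1 - Y (\<sigma> @ [A])) \<ge> 0" using \<epsilon>(1) Y by simp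
      ultimately show ?thesis
        using F2 unfolding FA by (simp only: right_diff_distrib)
    qed
    ultimately show ?thesis
      using IH adm
      by (intro exI[of _ "\<sigma> @ [A]"] exI[of _ k] exI[of _ U] exI[of _ "Suc S"])
         (simp del: of_nat_Suc)
  qed
qed

section \<open>Reduction to a fractional trajectory\<close>

text \<open>The initial state is 0, which the value at the empty history encodes.\<close>

definition prob_on ::
  "'w measure \<Rightarrow> (nat \<Rightarrow> 'w \<Rightarrow> 'r) \<Rightarrow> (nat \<Rightarrow> input list \<Rightarrow> 'r list \<Rightarrow> nat) \<Rightarrow> nat
    \<Rightarrow> input list \<Rightarrow> real" where
  "prob_on M R D T h = (if h = [] then 0 else \<integral>\<omega>. real (D T h (choices R (length h) \<omega>)) \<partial>M)"

lemma randomized_online_algorithm_state: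
  assumes "randomized_online_algorithm M R D"
  shows "integrable M (\<lambda>\<omega>. real (D T h (choices R (length h) \<omega>)))"
    and "\<omega> \<in> space M \<Longrightarrow> D T h (choices R (length h) \<omega>) \<in> {0, 1}"
proof -
  interpret prob_space M using assms by (simp add: randomized_online_algorithm_def)
  have m: "(\<lambda>\<omega>. D T h (choices R (length h) \<omega>)) \<in> measurable M (count_space {0, 1})"
    using assms unfolding randomized_online_algorithm_def by blast
  have *: "D T h (choices R (length h) \<omega>) \<in> {0, 1}" if "\<omega> \<in> space M" for \<omega>
    using measurable_space[OF m that] by simp
  from this show "\<omega> \<in> space M \<Longrightarrow> D T h (choices R (length h) \<omega>) \<in> {0, 1}" .
  have "(\<lambda>\<omega>. real (D T h (choices R (length h) \<omega>))) \<in> borel_measurable M"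
    by (rule measurable_compose[OF m]) simp
  then show "integrable M (\<lambda>\<omega>. real (D T h (choices R (length h) \<omega>)))"
    using * by (intro integrable_const_bound[of _ 1]) fastforce+
qed

lemma prob_on_bounds:
  assumes "randomized_online_algorithm M R D"
  shows "0 \<le> prob_on M R D T h \<and> prob_on M R D T h \<le> 1"
proof -
  interpret prob_space M using assms by (simp add: randomized_online_algorithm_def)
  have "real (D T h (choices R (length h) \<omega>)) \<le> 1" if "\<omega> \<in> space M" for \<omega>
    using randomized_online_algorithm_state(2)[OF assms that, of T h] by auto
  then have "(\<integral>\<omega>. real (D T h (choices R (length h) \<omega>)) \<partial>M) \<le> 1"
    using randomized_online_algorithm_state(1)[OF assms] by (intro integral_le_const AE_I2)
  then show ?thesis by (simp add: prob_on_def)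
qed

lemma op_cost_affine:
  assumes "s \<in> {0, 1}"
  shows "op_cost H x s = op_cost H x 0 * (1 - real s) + op_cost H x 1 * real s"
  using assms by auto

text \<open>The operating costs agree by linearity of expectation; the expected switching cost is at
  least that of the means because \<open>max v 0\<close> is convex.\<close>

lemma frac_cost_le_expected_cost:
  assumes "\<beta> \<ge> 0" and alg: "randomized_online_algorithm M R D"
  shows "frac_cost \<beta> H (prob_on M R D (length \<sigma>)) \<sigma> \<le> expected_cost \<beta> H 0 M R D \<sigma>"
proof -
  interpret prob_space M using alg by (simp add: randomized_online_algorithm_def)
  \<comment> \<open>\<open>X t\<close> is the state after \<open>t\<close> inputs and
    \<open>X 0\<close> the initial one, so \<open>X (Suc t)\<close> serves
    \<open>\<sigma> ! t\<close>.\<close>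
  define X where "X t \<omega> = (if t = 0 then 0
    else real (D (length \<sigma>) (take t \<sigma>) (choices R t \<omega>)))" for t \<omega>
  define Y where "Y = prob_on M R D (length \<sigma>)"
  have int: "integrable M (X t)" if "t \<le> length \<sigma>" for t
    using randomized_online_algorithm_state(1)[OF alg, of "length \<sigma>" "take t \<sigma>"] that
    by (cases "t = 0") (simp_all add: X_def[abs_def] min_absorb2)
  have EX: "(\<integral>\<omega>. X t \<omega> \<partial>M) = Y (take t \<sigma>)" if "t \<le> length \<sigma>" for t
    using that by (cases "t = 0") (auto simp: X_def Y_def prob_on_def min_def)
  define G where "G t \<omega> = op_cost H (\<sigma> ! t) 0 * (1 - X (Suc t) \<omega>) + op_cost H (\<sigma> ! t) 1 * X (Suc t) \<omega>
    + \<beta> * max (X (Suc t) \<omega> - X t \<omega>) 0" for t \<omega>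
  have cost: "cost \<beta> H 0 \<sigma> (schedule R D \<sigma> \<omega>) = (\<Sum>t<length \<sigma>. G t \<omega>)" if \<omega>: "\<omega> \<in> space M" for \<omega>
    unfolding cost_def
  proof (intro sum.cong refl)
    fix t assume "t \<in> {..<length \<sigma>}"
    then have t: "t < length \<sigma>" by simp
    have s: "schedule R D \<sigma> \<omega> ! t' = D (length \<sigma>) (take (Suc t') \<sigma>) (choices R (Suc t') \<omega>)"
      if "t' < length \<sigma>" for t'
      using that by (simp add: schedule_def del: upt_Suc)
    have "schedule R D \<sigma> \<omega> ! t \<in> {0, 1}"
      using randomized_online_algorithm_state(2)[OF alg \<omega>, of "length \<sigma>" "take (Suc t) \<sigma>"] t
      by (simp add: s min_absorb2)
    moreover have "real (schedule R D \<sigma> \<omega> ! t) = X (Suc t) \<omega>"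
      using t by (simp add: s X_def)
    moreover have "real ((0 # schedule R D \<sigma> \<omega>) ! t) = X t \<omega>"
      using t by (cases t) (auto simp: s X_def)
    ultimately show "op_cost H (\<sigma> ! t) (schedule R D \<sigma> \<omega> ! t)
        + \<beta> * max (real (schedule R D \<sigma> \<omega> ! t) - real ((0 # schedule R D \<sigma> \<omega>) ! t)) 0 = G t \<omega>"
      unfolding G_def by (metis op_cost_affine)
  qed
  have intG: "integrable M (G t)" if "t < length \<sigma>" for t
    unfolding G_def using int[of t] int[of "Suc t"] that by auto
  have "expected_cost \<beta> H 0 M R D \<sigma> = (\<integral>\<omega>. (\<Sum>t<length \<sigma>. G t \<omega>) \<partial>M)"
    unfolding expected_cost_def by (intro Bochner_Integration.integral_cong refl cost)
  also have "\<dots> = (\<Sum>t<length \<sigma>. \<integral>\<omega>. G t \<omega> \<partial>M)"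
    using intG by (intro Bochner_Integration.integral_sum) auto
  also have "\<dots> \<ge> (\<Sum>t<length \<sigma>. op_cost H (\<sigma> ! t) 0 * (1 - Y (take (Suc t) \<sigma>))
        + op_cost H (\<sigma> ! t) 1 * Y (take (Suc t) \<sigma>)
        + \<beta> * max (Y (take (Suc t) \<sigma>) - Y (take t \<sigma>)) 0)"
  proof (intro sum_mono)
    fix t assume "t \<in> {..<length \<sigma>}"
    then have t: "t < length \<sigma>" by simp
    note i = int[of t] int[of "Suc t"]
    have "max (Y (take (Suc t) \<sigma>) - Y (take t \<sigma>)) 0 \<le> (\<integral>\<omega>. max (X (Suc t) \<omega> - X t \<omega>) 0 \<partial>M)"
    proof (rule max.boundedI)
      have "Y (take (Suc t) \<sigma>) - Y (take t \<sigma>) = (\<integral>\<omega>. X (Suc t) \<omega> - X t \<omega> \<partial>M)"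
        using i t by (simp add: EX)
      also have "\<dots> \<le> (\<integral>\<omega>. max (X (Suc t) \<omega> - X t \<omega>) 0 \<partial>M)"
        using i t by (intro integral_mono) auto
      finally show "Y (take (Suc t) \<sigma>) - Y (take t \<sigma>) \<le> \<dots>" .
    qed (simp add: integral_nonneg_AE)
    from mult_left_mono[OF this \<open>\<beta> \<ge> 0\<close>]
    show "op_cost H (\<sigma> ! t) 0 * (1 - Y (take (Suc t) \<sigma>)) + op_cost H (\<sigma> ! t) 1 * Y (take (Suc t) \<sigma>)
        + \<beta> * max (Y (take (Suc t) \<sigma>) - Y (take t \<sigma>)) 0 \<le> (\<integral>\<omega>. G t \<omega> \<partial>M)"
      using i t unfolding G_def by (simp add: EX prob_space)
  qed
  finally show ?thesis by (simp add: frac_cost_def Y_def)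
qed

section \<open>Contradiction for a ratio below 2\<close>

text \<open>The gain per up step bounds \<open>U\<close>, and the cost of stuck steps then bounds
  \<open>S\<close>, both independently of the horizon \<open>m\<close>, although
  \<open>m \<le> 2 * U + S\<close>.\<close>

lemma competitive_ge_2:
  assumes \<beta>: "\<beta> > 0" and alg: "randomized_online_algorithm M R D"
    and comp: "competitive \<beta> H 0 M R D c"
  shows "c \<ge> 2"
proof (rule ccontr)
  assume "\<not> c \<ge> 2"
  \<comment> \<open>A nonnegative factor is needed to insert upper bounds on the optimum.\<close>
  define c' where "c' = max c 0"
  have c': "0 \<le> c'" "c \<le> c'" "c' < 2" using \<open>\<not> c \<ge> 2\<close> by (auto simp: c'_def)
  obtain \<gamma> where \<gamma>: "\<And>\<sigma>. \<sigma> \<noteq> [] \<Longrightarrow> \<forall>x\<in>set \<sigma>. admissible H x \<Longrightarrow>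
      expected_cost \<beta> H 0 M R D \<sigma> \<le> c * opt \<beta> H 0 \<sigma> + \<gamma>"
    using comp unfolding competitive_def by blast
  obtain n :: nat where n: "2 / (2 - c') < n" using reals_Archimedean2 by blast
  have n0: "n > 0" using n c' by (intro gr0I) (auto simp: field_simps)
  define \<epsilon> where "\<epsilon> = \<beta> / n"
  define \<theta> where "\<theta> = 1 / (2 * (real n)\<^sup>2)"
  \<comment> \<open>Net gain per up step: \<open>2 * \<epsilon>\<close>, less the loss of this step
    and of a later down step, less the share of the optimum. The choice of \<open>n\<close> makes it
    positive.\<close>
  define a where "a = 2 * \<epsilon> - 2 * (\<epsilon> / n) - c' * \<epsilon>"
  have \<epsilon>: "\<epsilon> > 0" and \<theta>: "\<theta> > 0" using \<beta> n0 by (auto simp: \<epsilon>_def \<theta>_def)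
  have "2 / n < 2 - c'" using n n0 c' by (simp add: field_simps)
  then have "\<epsilon> * (2 / n) < \<epsilon> * (2 - c')" using \<epsilon> by (rule mult_strict_left_mono)
  then have a: "a > 0" by (simp add: a_def algebra_simps)
  define K where "K = (\<gamma> + 2 * \<beta>) / a"
  define L where "L = 2 * K + 2 * (c' * \<epsilon> * K + \<gamma>) / (\<epsilon> * \<theta>)"
  have bound: "real m \<le> L" if "m > 0" for m
  proof -
    \<comment> \<open>The algorithm may depend on the horizon, so the sequence is built against its
      probabilities for horizon \<open>m\<close>.\<close>
    define Y where "Y = prob_on M R D m"
    have Y: "Y [] = 0" "\<And>h. 0 \<le> Y h \<and> Y h \<le> 1"
      using prob_on_bounds[OF alg] by (auto simp: Y_def prob_on_def)
    obtain \<sigma> k U S where \<sigma>: "length \<sigma> = m" "\<forall>x\<in>set \<sigma>. admissible H x" "k \<le> n"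
      "m + k = 2 * U + S" "reachable_within \<beta> H \<sigma> 0 (\<epsilon> * U)"
      and F1: "2 * frac_cost \<beta> H Y \<sigma> - \<beta> * Y \<sigma> \<ge> \<epsilon> * \<theta> * S"
      and F2: "frac_cost \<beta> H Y \<sigma> + (\<beta> * max (k / n - Y \<sigma>) 0 + \<beta> * (k / n)\<^sup>2 / 2)
        \<ge> 2 * \<epsilon> * U - \<epsilon> / n * (2 * real U - k)"
      using adversary[where Y = Y and m = m and H = H, OF \<beta> n0 Y] unfolding \<epsilon>_def \<theta>_def by blast
    have "frac_cost \<beta> H Y \<sigma> \<le> expected_cost \<beta> H 0 M R D \<sigma>"
      using frac_cost_le_expected_cost[OF _ alg, of \<beta> H \<sigma>] \<beta> \<sigma>(1) by (simp add: Y_def)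
    also have "\<dots> \<le> c * opt \<beta> H 0 \<sigma> + \<gamma>"
      using \<gamma> \<sigma> that by auto
    also have "c * opt \<beta> H 0 \<sigma> \<le> c' * opt \<beta> H 0 \<sigma>"
      using c' opt_nonneg[of \<beta> \<sigma> H] \<beta> \<sigma> by (intro mult_right_mono) auto
    also have "c' * opt \<beta> H 0 \<sigma> \<le> c' * (\<epsilon> * U)"
      using c' opt_le_if_reachable_within[OF \<sigma>(5)] by (intro mult_left_mono) auto
    finally have F: "frac_cost \<beta> H Y \<sigma> \<le> c' * \<epsilon> * U + \<gamma>" by (simp add: mult.assoc)
    have kn: "0 \<le> k / n" "k / n \<le> (1::real)" using \<sigma>(3) n0 by auto
    \<comment> \<open>The potential is at most 3/2 \<beta>, rounded up to \<open>2 * \<beta>\<close>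
      below.\<close>
    have "\<beta> * max (k / n - Y \<sigma>) 0 \<le> \<beta> * 1"
      using \<beta> Y(2)[of \<sigma>] kn by (intro mult_left_mono) auto
    moreover have "\<beta> * (k / n)\<^sup>2 \<le> \<beta> * 1"
      using \<beta> kn by (intro mult_left_mono power_le_one) auto
    moreover have "\<epsilon> / n * (2 * real U - k) \<le> \<epsilon> / n * (2 * real U)"
      using \<epsilon> by (intro mult_left_mono) auto
    ultimately have "2 * \<epsilon> * U - \<epsilon> / n * (2 * real U) \<le> c' * \<epsilon> * U + \<gamma> + 2 * \<beta>"
      using F F2 \<beta> by linarith
    then have "a * U \<le> \<gamma> + 2 * \<beta>" by (simp add: a_def algebra_simps)
    then have U: "U \<le> K" using a by (simp add: K_def field_simps)
    have "0 \<le> \<beta> * Y \<sigma>" using \<beta> Y(2) by simp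
    then have "\<epsilon> * \<theta> * S \<le> 2 * frac_cost \<beta> H Y \<sigma>" using F1 by linarith
    also have "\<dots> \<le> 2 * (c' * \<epsilon> * U + \<gamma>)" using F by simp
    also have "c' * \<epsilon> * U \<le> c' * \<epsilon> * K" using U c' \<epsilon> by (intro mult_left_mono) auto
    finally have "S \<le> 2 * (c' * \<epsilon> * K + \<gamma>) / (\<epsilon> * \<theta>)"
      using \<epsilon> \<theta> by (simp add: pos_le_divide_eq mult.commute)
    moreover have "real m \<le> 2 * real U + real S" using \<sigma>(4) by linarith
    ultimately show ?thesis using U by (simp add: L_def)
  qed
  obtain m :: nat where "L < m" using reals_Archimedean2 by blast
  then show False using bound[of "Suc m"] by simp
qed

theorem theorem6:
  fixes \<beta> H :: real
    and M :: "'w measure"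
    and R :: "nat \<Rightarrow> 'w \<Rightarrow> 'r"
    and D :: "nat \<Rightarrow> input list \<Rightarrow> 'r list \<Rightarrow> nat"
  assumes "\<beta> > 0"
    and "randomized_online_algorithm M R D"
  shows "expected_competitive_ratio \<beta> H 0 M R D \<ge> 2"
  unfolding expected_competitive_ratio_def
proof (rule Inf_greatest, elim imageE, clarify)
  fix c assume "competitive \<beta> H 0 M R D c"
  then have "c \<ge> 2" using competitive_ge_2 assms by blast
  then show "2 \<le> ereal c" by simp
qed

end
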